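(* Let $E_{0j}=I\otimes e_j$, $E_{j0}=e_j\otimes I$ and $E_{jl}=E_{j0}E_{0l}=e_j\otimes e_l$ for $j,l\in\{1,2,3\}$, and let $\psi=\psi_1\psi_2\psi_3$ with $$\psi_1=\frac{E_{11}-1}{2},\qquad \psi_2=\frac{E_{22}-1}{2},\qquad \psi_3=\frac{E_{33}-1}{2},$$ so that $E_{11}\psi=-\psi$, $E_{22}\psi=-\psi$, $E_{33}\psi=-\psi$. Then $$E_{01}\psi=-E_{10}\psi=-iE_{23}\psi,\qquad E_{02}\psi=-E_{20}\psi=iE_{13}\psi,\qquad E_{03}\psi=-E_{30}\psi=iE_{21}\psi,$$ $$E_{12}\psi=-E_{21}\psi,\qquad E_{23}\psi=-E_{32}\psi,\qquad E_{13}\psi=-E_{31}\psi .$$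
   Context: $e_1,e_2,e_3$ are the Pauli matrices $$e_1=\begin{pmatrix}0&1\\1&0\end{pmatrix},\quad e_2=\begin{pmatrix}0&-i\\ i&0\end{pmatrix},\quad e_3=\begin{pmatrix}1&0\\0&-1\end{pmatrix},$$ satisfying $e_j^2=1$, $e_1e_2=-e_2e_1=ie_3$ and cyclic permutations; $I$ is the $2\times 2$ identity matrix, $\otimes$ is the Kronecker product, and $1$ denotes the $4\times4$ identity matrix. All elements live in the algebra of $4\times4$ complex matrices, and $i$ is the imaginary unit. *)

theory Defs
  imports "Jordan_Normal_Form.Matrix" Complex_Main
begin

definition kronecker :: "complex mat \<Rightarrow> complex mat \<Rightarrow> complex mat" (infixl "\<otimes>\<^sub>k" 75) where
  "A \<otimes>\<^sub>k B = mat (dim_row A * dim_row B) (dim_col A * dim_col B)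
     (\<lambda>(r, c). A $$ (r div dim_row B, c div dim_col B) * B $$ (r mod dim_row B, c mod dim_col B))"

definition pauli :: "nat \<Rightarrow> complex mat" where
  "pauli j =
    (if j = 1 then mat_of_rows_list 2 [[0, 1], [1, 0]]
     else if j = 2 then mat_of_rows_list 2 [[0, - \<i>], [\<i>, 0]]
     else if j = 3 then mat_of_rows_list 2 [[1, 0], [0, - 1]]
     else 0\<^sub>m 2 2)"

definition E_right :: "nat \<Rightarrow> complex mat" where
  "E_right j = 1\<^sub>m 2 \<otimes>\<^sub>k pauli j"

definition E_left :: "nat \<Rightarrow> complex mat" where
  "E_left j = pauli j \<otimes>\<^sub>k 1\<^sub>m 2"

text \<open>\<open>E 0 j\<close>, \<open>E j 0\<close> and \<open>E j l\<close> for \<open>j, l\<close> in \<open>{1, 2, 3}\<close> are the matrices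
  $E_{0j}$, $E_{j0}$ and $E_{jl}$. The remaining values of \<open>E\<close> and \<open>pauli\<close> are irrelevant.\<close>

definition E :: "nat \<Rightarrow> nat \<Rightarrow> complex mat" where
  "E j l =
    (if j = 0 then E_right l
     else if l = 0 then E_left j
     else E_left j * E_right l)"

definition psi_factor :: "nat \<Rightarrow> complex mat" where
  "psi_factor j = (1 / 2) \<cdot>\<^sub>m (E j j - 1\<^sub>m 4)"

definition psi :: "complex mat" ("\<psi>") where
  "\<psi> = psi_factor 1 * psi_factor 2 * psi_factor 3"

end

theory Submission
  imports Defs
begin

text \<open>The factors of \<open>\<psi>\<close> are the negatives of the projections onto the \<open>-1\<close> eigenspaces of
  $E_{11}, E_{22}, E_{33}$, so \<open>\<psi>\<close> is the negative of the rank-one projection onto the singlet vector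
  $(0, 1, -1, 0)/\sqrt 2$. With \<open>\<psi>\<close> in this explicit form, all identities are entrywise
  computations.\<close>

lemma kronecker_2_2:
  "mat_of_rows_list 2 [[a, b], [c, d]] \<otimes>\<^sub>k mat_of_rows_list 2 [[p, q], [r, s]] =
   mat_of_rows_list 4
     [[a * p, a * q, b * p, b * q],
      [a * r, a * s, b * r, b * s],
      [c * p, c * q, d * p, d * q],
      [c * r, c * s, d * r, d * s]]"
proof -
  \<comment> \<open>Index 3 appears in \<open>Suc\<close> form after \<open>numeral_eq_Suc\<close>;
    these are the block and offset that it has in a 2 by 2 block layout.\<close>
  have "Suc (Suc (Suc 0)) div Suc (Suc 0) = 1" "Suc (Suc (Suc 0)) mod Suc (Suc 0) = 1"
    by presburger+
  then show ?thesis
    by (intro eq_matI)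
      (auto simp: kronecker_def mat_of_rows_list_def less_Suc_eq numeral_eq_Suc)
qed

lemma one_mat_2: "1\<^sub>m 2 = mat_of_rows_list 2 [[1, 0], [0, 1]]"
  by (rule eq_matI) (auto simp: mat_of_rows_list_def less_Suc_eq numeral_eq_Suc)

lemma one_mat_4:
  "1\<^sub>m 4 = mat_of_rows_list 4 [[1, 0, 0, 0], [0, 1, 0, 0], [0, 0, 1, 0], [0, 0, 0, 1]]"
  by (rule eq_matI) (auto simp: mat_of_rows_list_def less_Suc_eq numeral_eq_Suc)

lemma mat_4_mult:
  fixes a11 :: "'a :: semiring_0"
  shows
  "mat_of_rows_list 4
     [[a11, a12, a13, a14], [a21, a22, a23, a24], [a31, a32, a33, a34], [a41, a42, a43, a44]] *
   mat_of_rows_list 4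
     [[b11, b12, b13, b14], [b21, b22, b23, b24], [b31, b32, b33, b34], [b41, b42, b43, b44]] =
   mat_of_rows_list 4 (map (\<lambda>(x, y, z, w).
     [x * b11 + y * b21 + z * b31 + w * b41, x * b12 + y * b22 + z * b32 + w * b42,
      x * b13 + y * b23 + z * b33 + w * b43, x * b14 + y * b24 + z * b34 + w * b44])
     [(a11, a12, a13, a14), (a21, a22, a23, a24), (a31, a32, a33, a34), (a41, a42, a43, a44)])"
  by (rule eq_matI)
    (auto simp: mat_of_rows_list_def scalar_prod_def less_Suc_eq numeral_eq_Suc add.assoc)

lemma mat_4_minus:
  fixes a11 :: "'a :: group_add"
  shows
  "mat_of_rows_list 4
     [[a11, a12, a13, a14], [a21, a22, a23, a24], [a31, a32, a33, a34], [a41, a42, a43, a44]] -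
   mat_of_rows_list 4
     [[b11, b12, b13, b14], [b21, b22, b23, b24], [b31, b32, b33, b34], [b41, b42, b43, b44]] =
   mat_of_rows_list 4
     [[a11 - b11, a12 - b12, a13 - b13, a14 - b14], [a21 - b21, a22 - b22, a23 - b23, a24 - b24],
      [a31 - b31, a32 - b32, a33 - b33, a34 - b34], [a41 - b41, a42 - b42, a43 - b43, a44 - b44]]"
  by (rule eq_matI) (auto simp: mat_of_rows_list_def less_Suc_eq numeral_eq_Suc)

lemma mat_4_smult:
  "k \<cdot>\<^sub>m mat_of_rows_list 4
     [[a11, a12, a13, a14], [a21, a22, a23, a24], [a31, a32, a33, a34], [a41, a42, a43, a44]] =
   mat_of_rows_list 4
     (map (map ((*) k))
       [[a11, a12, a13, a14], [a21, a22, a23, a24], [a31, a32, a33, a34], [a41, a42, a43, a44]])"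
  by (rule eq_matI) (auto simp: mat_of_rows_list_def less_Suc_eq numeral_eq_Suc)

lemma mat_4_uminus:
  "- mat_of_rows_list 4
     [[a11, a12, a13, a14], [a21, a22, a23, a24], [a31, a32, a33, a34], [a41, a42, a43, a44]] =
   mat_of_rows_list 4
     (map (map uminus)
       [[a11, a12, a13, a14], [a21, a22, a23, a24], [a31, a32, a33, a34], [a41, a42, a43, a44]])"
  by (rule eq_matI) (auto simp: mat_of_rows_list_def less_Suc_eq numeral_eq_Suc)

lemma pauli_simps:
  "pauli 1 = mat_of_rows_list 2 [[0, 1], [1, 0]]"
  "pauli 2 = mat_of_rows_list 2 [[0, - \<i>], [\<i>, 0]]"
  "pauli 3 = mat_of_rows_list 2 [[1, 0], [0, - 1]]"
  by (simp_all add: pauli_def)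

text \<open>An instance of the mixed-product rule (A \<otimes> I)(I \<otimes> B) = A \<otimes> B,
  checked on the nine index pairs rather than derived in general.\<close>

lemma E_eq_kronecker:
  assumes "j \<in> {1, 2, 3}" and "l \<in> {1, 2, 3}"
  shows "E j l = pauli j \<otimes>\<^sub>k pauli l"
  using assms unfolding E_def E_left_def E_right_def
  by (elim insertE emptyE)
    \<comment> \<open>The simplifier turns index \<open>1\<close> into \<open>Suc 0\<close>, so
      \<open>pauli_simps(1)\<close> is also supplied with its left side in that form.\<close>
    (simp_all add: pauli_simps pauli_simps(1)[simplified] one_mat_2 kronecker_2_2 mat_4_mult)

lemma E_0_j: "E 0 j = 1\<^sub>m 2 \<otimes>\<^sub>k pauli j"
  by (simp add: E_def E_right_def)

lemma E_j_0: "j \<noteq> 0 \<Longrightarrow> E j 0 = pauli j \<otimes>\<^sub>k 1\<^sub>m 2"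
  by (simp add: E_def E_left_def)

text \<open>A rewrite chain: \<open>E\<close> at concrete indices becomes a Kronecker product, then
  an explicit 4 by 4 matrix on which the \<open>mat_4\<close> rules compute.\<close>

lemmas E_explicit =
  E_eq_kronecker E_0_j E_j_0 pauli_simps pauli_simps(1)[simplified] one_mat_2 kronecker_2_2

text \<open>The inner block is minus the outer product of (1, -1)/sqrt 2 with itself; the sign is
  (-1)^3, one for each factor.\<close>

lemma psi_explicit:
  "\<psi> = mat_of_rows_list 4
     [[0, 0, 0, 0], [0, - (1 / 2), 1 / 2, 0], [0, 1 / 2, - (1 / 2), 0], [0, 0, 0, 0]]"
  by (simp add: psi_def psi_factor_def E_explicit one_mat_4 mat_4_minus mat_4_smult mat_4_mult)

theorem mainTheorem4:
  "(\<forall>j\<in>{1, 2, 3}. \<forall>l\<in>{1, 2, 3}. E j l = pauli j \<otimes>\<^sub>k pauli l) \<and>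
   (E 1 1 * \<psi> = - \<psi> \<and> E 2 2 * \<psi> = - \<psi> \<and> E 3 3 * \<psi> = - \<psi>) \<and>
   (E 0 1 * \<psi> = - (E 1 0 * \<psi>) \<and> - (E 1 0 * \<psi>) = (- \<i>) \<cdot>\<^sub>m (E 2 3 * \<psi>)) \<and>
   (E 0 2 * \<psi> = - (E 2 0 * \<psi>) \<and> - (E 2 0 * \<psi>) = \<i> \<cdot>\<^sub>m (E 1 3 * \<psi>)) \<and>
   (E 0 3 * \<psi> = - (E 3 0 * \<psi>) \<and> - (E 3 0 * \<psi>) = \<i> \<cdot>\<^sub>m (E 2 1 * \<psi>)) \<and>
   E 1 2 * \<psi> = - (E 2 1 * \<psi>) \<and>
   E 2 3 * \<psi> = - (E 3 2 * \<psi>) \<and>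
   E 1 3 * \<psi> = - (E 3 1 * \<psi>)"
  \<comment> \<open>\<open>E_eq_kronecker\<close> reduces the first conjunct to index membership;
    the others become equalities of explicit matrices. Conceptually, the singlet has total spin
    zero, so \<open>E 0 j + E j 0\<close> annihilates \<open>\<psi>\<close>, and
    \<open>E j l * \<psi>\<close> is minus (e_j e_l \<otimes> I) \<open>\<psi>\<close>,
    antisymmetric for distinct j and l.\<close>
  by (intro conjI ballI E_eq_kronecker)
    (simp_all add: E_explicit psi_explicit mat_4_mult mat_4_smult mat_4_uminus)

end
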